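(* Every $2\times 2$ monotone grid class is finitely based. That is, if $\mathcal{M}$ is any $2\times 2$ matrix each of whose entries is one of the permutation classes $\operatorname{Av}(12)$, $\operatorname{Av}(21)$ or the empty class $\emptyset$, then $\operatorname{Grid}(\mathcal{M})$ has a finite basis.
   Context: Permutations are identified with their plots $\{(i,\pi(i))\}$ in the plane. $\sigma\le\pi$ (containment) if some subsequence of $\pi$ is order-isomorphic to $\sigma$. A permutation class is a set of permutations closed downward under containment (the empty permutation belongs to every class). The basis of a class $\mathcal{C}$ is the set of minimal (under containment) permutations not in $\mathcal{C}$; $\mathcal{C}$ is finitely based if its basis is finite. $\operatorname{Av}(B)$ denotes the set of permutations containing no element of $B$. For an $m\times n$ matrix $\mathcal{M}$ of permutation classes, $\operatorname{Grid}(\mathcal{M})$ is the set of permutations $\pi$ for which there exist $m-1$ horizontal and $n-1$ vertical lines dividing the plot of $\pi$ into $mn$ rectangles such that the (possibly zero) points of $\pi$ in each rectangle form a permutation belonging to the class in the corresponding entry of $\mathcal{M}$ (rows of $\mathcal{M}$ correspond to horizontal strips from top to bottom, columns to vertical strips from left to right). A monotone grid class is one where every entry of $\mathcal{M}$ is $\operatorname{Av}(12)$, $\operatorname{Av}(21)$ or $\emptyset$. *)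

theory Defs
  imports
    Complex_Main
    "HOL-Library.Sublist"
    "HOL-Combinatorics.Multiset_Permutations"
    "Jordan_Normal_Form.Matrix"
begin

section \<open>Permutations and containment\<close>

text \<open>Permutations of \<open>{1..n}\<close> in one-line notation, for all \<open>n \<ge> 0\<close>.\<close>

definition is_perm :: "nat list \<Rightarrow> bool" where
  "is_perm \<pi> \<longleftrightarrow> \<pi> \<in> permutations_of_set {1..length \<pi>}"

definition order_iso :: "nat list \<Rightarrow> nat list \<Rightarrow> bool" where
  "order_iso xs ys \<longleftrightarrow> length xs = length ys \<and>
     (\<forall>i < length xs. \<forall>j < length xs. xs ! i < xs ! j \<longleftrightarrow> ys ! i < ys ! j)"

definition contained :: "nat list \<Rightarrow> nat list \<Rightarrow> bool"  (infix "\<preceq>" 50) where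
  "\<sigma> \<preceq> \<pi> \<longleftrightarrow> (\<exists>\<tau>. subseq \<tau> \<pi> \<and> order_iso \<tau> \<sigma>)"

definition Av :: "nat list set \<Rightarrow> nat list set" where
  "Av B = {\<pi>. is_perm \<pi> \<and> (\<forall>\<beta>\<in>B. \<not> \<beta> \<preceq> \<pi>)}"

text \<open>The empty permutation belongs to every class, so the class denoted by \<open>\<emptyset>\<close> in a
  gridding matrix consists of the empty permutation only: the corresponding rectangle
  contains no points.\<close>

definition empty_class :: "nat list set" where
  "empty_class = {[]}"

definition basis :: "nat list set \<Rightarrow> nat list set" where
  "basis C = {\<beta>. is_perm \<beta> \<and> \<beta> \<notin> C \<and>
     (\<forall>\<sigma>. is_perm \<sigma> \<and> \<sigma> \<notin> C \<and> \<sigma> \<preceq> \<beta> \<longrightarrow> \<sigma> = \<beta>)}"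

definition finitely_based :: "nat list set \<Rightarrow> bool" where
  "finitely_based C \<longleftrightarrow> finite (basis C)"

section \<open>Grid classes\<close>

text \<open>List positions count from 0, so position \<open>k\<close> is plotted at abscissa \<open>k + 1\<close>.\<close>

definition point :: "nat list \<Rightarrow> nat \<Rightarrow> real \<times> real" where
  "point \<pi> k = (real (k + 1), real (\<pi> ! k))"

definition plot :: "nat list \<Rightarrow> (real \<times> real) set" where
  "plot \<pi> = point \<pi> ` {..<length \<pi>}"

text \<open>The entries of \<open>\<pi>\<close> plotted inside a region, read from left to right.\<close>

definition entries_in :: "nat list \<Rightarrow> (real \<times> real) set \<Rightarrow> nat list" where
  "entries_in \<pi> R = nths \<pi> {k. point \<pi> k \<in> R}"

text \<open>The points in a region form the unique permutation order isomorphic to these entries.\<close>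

definition forms_member :: "nat list \<Rightarrow> (real \<times> real) set \<Rightarrow> nat list set \<Rightarrow> bool" where
  "forms_member \<pi> R C \<longleftrightarrow> (\<exists>\<sigma>\<in>C. is_perm \<sigma> \<and> order_iso (entries_in \<pi> R) \<sigma>)"

text \<open>An increasing list of \<open>r\<close> numbers cuts the real line into \<open>r + 1\<close> open intervals, of which
  \<open>strip ls k\<close> is the one with index \<open>k \<in> {0..r}\<close>; the two outermost ones are unbounded.\<close>

definition strip :: "real list \<Rightarrow> nat \<Rightarrow> real set" where
  "strip ls k = {x. (0 < k \<longrightarrow> ls ! (k - 1) < x) \<and> (k < length ls \<longrightarrow> x < ls ! k)}"

text \<open>The lists \<open>vs\<close> and \<open>hs\<close> hold the abscissae of the vertical and the ordinates of the
  horizontal lines. The lines pass through no point of the plot. Row \<open>0\<close> of the matrix is its top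
  row, whereas strips are counted upwards, which explains the index \<open>dim_row M - 1 - i\<close>.\<close>

definition is_gridding :: "nat list set mat \<Rightarrow> nat list \<Rightarrow> real list \<Rightarrow> real list \<Rightarrow> bool" where
  "is_gridding M \<pi> vs hs \<longleftrightarrow>
     length vs + 1 = dim_col M \<and> sorted_wrt (<) vs \<and>
     length hs + 1 = dim_row M \<and> sorted_wrt (<) hs \<and>
     (\<forall>(x, y) \<in> plot \<pi>. x \<notin> set vs \<and> y \<notin> set hs) \<and>
     (\<forall>i < dim_row M. \<forall>j < dim_col M.
        forms_member \<pi> (strip vs j \<times> strip hs (dim_row M - 1 - i)) (M $$ (i, j)))"

definition Grid :: "nat list set mat \<Rightarrow> nat list set" where
  "Grid M = {\<pi>. is_perm \<pi> \<and> (\<exists>vs hs. is_gridding M \<pi> vs hs)}"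

definition monotone_matrix :: "nat list set mat \<Rightarrow> bool" where
  "monotone_matrix M \<longleftrightarrow>
     (\<forall>i < dim_row M. \<forall>j < dim_col M. M $$ (i, j) \<in> {Av {[1, 2]}, Av {[2, 1]}, empty_class})"

end

theory Submission
  imports Defs
begin

text \<open>Fix the horizontal line at height \<open>h\<close>. The vertical lines at abscissa \<open>v\<close> that suit the top row
  form an interval which grows with \<open>h\<close>, and those that suit the bottom row form an interval which
  shrinks with \<open>h\<close>. If no pair of lines works, at most four points show that one of the two
  intervals is empty for \<open>h\<close> below a certain range, and at most four for \<open>h\<close> above it. Within the
  range both intervals are nonempty and disjoint; by monotonicity the same one is the left one for all
  \<open>h\<close>, say the one of the bottom row. Then for every \<open>h\<close> of the range an obstruction \<open>s\<close> in the bottom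
  left cell lies to the left of an obstruction \<open>t\<close> in the top right cell. Let \<open>c(h)\<close> be the
  greatest possible abscissa of the left end of \<open>t\<close>. The right end of \<open>s\<close> and the left end of \<open>t\<close> form
  an increasing pair, which restricts the types of the other two cells so much that, up to
  a rotation by 180 degrees, \<open>c\<close> takes at most two values. For each value \<open>w\<close> one \<open>s\<close>, chosen for the
  least \<open>h\<close>, and one \<open>t\<close>, chosen for the greatest, suffice. So every permutation outside the class
  contains one of length at most \<open>4 + 4 + 2 * 4 = 16\<close> outside the class.\<close>

subsection \<open>Point sets cut by two lines\<close>

type_synonym pt = "int \<times> int"

datatype cell = Inc | Dec | Void

text \<open>An obstruction may consist of a single point, \<open>p = q\<close>, in a cell that has to be empty.\<close>

fun bad :: "cell \<Rightarrow> pt \<Rightarrow> pt \<Rightarrow> bool" where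
  "bad Inc p q \<longleftrightarrow> fst p < fst q \<and> snd q < snd p \<or> fst q < fst p \<and> snd p < snd q"
| "bad Dec p q \<longleftrightarrow> fst p < fst q \<and> snd p < snd q \<or> fst q < fst p \<and> snd q < snd p"
| "bad Void p q \<longleftrightarrow> True"

definition good :: "cell \<Rightarrow> pt set \<Rightarrow> bool" where
  "good T S \<longleftrightarrow> (\<forall>p\<in>S. \<forall>q\<in>S. \<not> bad T p q)"

text \<open>The integer \<open>v\<close> stands for a line strictly between the abscissae
  \<open>v\<close> and \<open>v + 1\<close>.\<close>

definition row_fits :: "cell \<Rightarrow> cell \<Rightarrow> pt set \<Rightarrow> int \<Rightarrow> bool" where
  "row_fits A B P v \<longleftrightarrow> good A {p\<in>P. fst p \<le> v} \<and> good B {p\<in>P. v < fst p}"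

definition pts_above :: "pt set \<Rightarrow> int \<Rightarrow> pt set" where
  "pts_above P h = {p\<in>P. h < snd p}"

definition pts_below :: "pt set \<Rightarrow> int \<Rightarrow> pt set" where
  "pts_below P h = {p\<in>P. snd p \<le> h}"

definition fits :: "cell \<Rightarrow> cell \<Rightarrow> cell \<Rightarrow> cell \<Rightarrow> pt set \<Rightarrow> int \<Rightarrow> int \<Rightarrow> bool" where
  "fits A B C D P v h \<longleftrightarrow> row_fits A B (pts_above P h) v \<and> row_fits C D (pts_below P h) v"

lemma bad_sym: "bad T p q \<Longrightarrow> bad T q p"
  by (cases T) auto

lemma good_mono: "good T S' \<Longrightarrow> S \<subseteq> S' \<Longrightarrow> good T S"
  unfolding good_def by blast

lemma good_empty [simp]: "good T {}"
  by (simp add: good_def)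

lemma row_fits_mono: "row_fits A B P' v \<Longrightarrow> P \<subseteq> P' \<Longrightarrow> row_fits A B P v"
  unfolding row_fits_def by (auto elim!: good_mono)

lemma pts_above_mono: "P \<subseteq> P' \<Longrightarrow> h' \<le> h \<Longrightarrow> pts_above P h \<subseteq> pts_above P' h'"
  unfolding pts_above_def by auto

lemma pts_below_mono: "P \<subseteq> P' \<Longrightarrow> h \<le> h' \<Longrightarrow> pts_below P h \<subseteq> pts_below P' h'"
  unfolding pts_below_def by auto

lemma fits_mono: "fits A B C D P' v h \<Longrightarrow> P \<subseteq> P' \<Longrightarrow> fits A B C D P v h"
  unfolding fits_def by (meson row_fits_mono pts_above_mono pts_below_mono order_refl)

lemma not_goodE:
  assumes "\<not> good T S"
  obtains p q where "p \<in> S" "q \<in> S" "bad T p q" "fst p \<le> fst q"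
  using assms bad_sym unfolding good_def by (metis linear)

lemma not_good_witness:
  assumes "\<not> good T S"
  obtains W where "W \<subseteq> S" "card W \<le> 2" "\<not> good T W"
proof -
  obtain p q where "p \<in> S" "q \<in> S" "bad T p q"
    using assms by (rule not_goodE)
  then show thesis
    by (intro that[of "{p, q}"]) (auto simp: good_def card_insert_if)
qed

section \<open>Bounds and last positions among the integers\<close>

lemma finite_int_bounds:
  fixes f :: "'a \<Rightarrow> int"
  assumes "finite P"
  obtains m M where "m \<le> M" "\<And>p. p \<in> P \<Longrightarrow> m < f p \<and> f p \<le> M"
proof -
  \<comment> \<open>The inserted 0 lets minimum and maximum exist even for empty \<open>P\<close>.
    Subtracting 1 below puts every value strictly above \<open>m\<close>, so that no point lies left
    of the line \<open>m\<close>.\<close>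
  have "finite (insert 0 (f ` P))" using assms by simp
  then have "\<forall>x\<in>insert 0 (f ` P). Min (insert 0 (f ` P)) \<le> x \<and> x \<le> Max (insert 0 (f ` P))"
    by auto
  then show thesis
    by (intro that[of "Min (insert 0 (f ` P)) - 1" "Max (insert 0 (f ` P))"]) force+
qed

lemma finite_bounded_int_Collect [simp]: "finite {h::int. a \<le> h \<and> h \<le> b \<and> Q h}"
  by (rule finite_subset[of _ "{a..b}"]) auto

text \<open>The greatest integer of the interval satisfying \<open>Q\<close> is not
  \<open>b\<close>, so its successor is still in the interval and fails.\<close>

lemma last_int:
  fixes a b :: int
  assumes "Q a" "\<not> Q b" "a \<le> b"
  obtains v where "a \<le> v" "v < b" "Q v" "\<not> Q (v + 1)"
proof -
  have "finite {v\<in>{a..b}. Q v}" "a \<in> {v\<in>{a..b}. Q v}" using assms by auto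
  then have *: "Max {v\<in>{a..b}. Q v} \<in> {v\<in>{a..b}. Q v}" (is "?v \<in> _")
    by (intro Max_in) auto
  then have "?v < b" using assms by (auto simp: less_le)
  moreover have "\<not> Q (?v + 1)"
  proof
    assume "Q (?v + 1)"
    then have "?v + 1 \<in> {v\<in>{a..b}. Q v}" using * \<open>?v < b\<close> by auto
    then have "?v + 1 \<le> ?v" by (intro Max_ge) auto
    then show False by simp
  qed
  ultimately show thesis using * that by auto
qed

section \<open>Few points that obstruct a single row\<close>

lemma row_fits_witness:
  assumes "finite P" "\<And>v. \<not> row_fits A B P v"
  obtains S where "S \<subseteq> P" "card S \<le> 4" "\<And>v. \<not> row_fits A B S v"
proof -
  obtain m M where mM: "m \<le> M" "\<And>p. p \<in> P \<Longrightarrow> m < fst p \<and> fst p \<le> M"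
    using finite_int_bounds[OF assms(1), of fst] by blast
  have l: "{p\<in>P. fst p \<le> m} = {}" and r: "{p\<in>P. M < fst p} = {}" using mM by force+
  have "\<not> good B {p\<in>P. m < fst p}"
    using assms(2)[of m] unfolding row_fits_def l by simp
  moreover have "\<not> \<not> good B {p\<in>P. M < fst p}" unfolding r by simp
  \<comment> \<open>At \<open>v\<close> the right cell fails for the last time. No line suits the
    row, so at \<open>v + 1\<close> the left cell fails.\<close>
  ultimately obtain v where v: "\<not> good B {p\<in>P. v < fst p}" "good B {p\<in>P. v + 1 < fst p}"
    using last_int[of "\<lambda>v. \<not> good B {p\<in>P. v < fst p}" m M] mM by blast
  then have "\<not> good A {p\<in>P. fst p \<le> v + 1}" using assms(2)[of "v+1"] unfolding row_fits_def by blast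
  then obtain W1 where W1: "W1 \<subseteq> {p\<in>P. fst p \<le> v + 1}" "card W1 \<le> 2" "\<not> good A W1"
    by (rule not_good_witness)
  obtain W2 where W2: "W2 \<subseteq> {p\<in>P. v < fst p}" "card W2 \<le> 2" "\<not> good B W2"
    using v(1) by (rule not_good_witness)
  show thesis
  proof (rule that[of "W1 \<union> W2"])
    show "W1 \<union> W2 \<subseteq> P" using W1 W2 by auto
    show "card (W1 \<union> W2) \<le> 4" using card_Un_le[of W1 W2] W1 W2 by linarith
    fix u
    \<comment> \<open>\<open>W2\<close> stays right of every line up to \<open>v\<close>, and
      \<open>W1\<close> stays left of every later one.\<close>
    show "\<not> row_fits A B (W1 \<union> W2) u"
    proof (cases "u \<le> v")
      case True
      then have "W2 \<subseteq> {p\<in>W1 \<union> W2. u < fst p}" using W2 by auto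
      then show ?thesis using W2(3) good_mono unfolding row_fits_def by blast
    next
      case False
      then have "W1 \<subseteq> {p\<in>W1 \<union> W2. fst p \<le> u}" using W1 by auto
      then show ?thesis using W1(3) good_mono unfolding row_fits_def by blast
    qed
  qed
qed

text \<open>Raising the line removes points from the top row, so four points that obstruct it at the
  greatest infeasible height do so at all lower heights.\<close>

lemma pts_above_witness:
  assumes "finite P"
  obtains S where "S \<subseteq> P" "card S \<le> 4"
    "\<And>h v. m \<le> h \<Longrightarrow> h \<le> M \<Longrightarrow> \<forall>v. \<not> row_fits A B (pts_above P h) v \<Longrightarrow> \<not> row_fits A B (pts_above S h) v"
proof (cases "\<exists>h\<in>{m..M}. \<forall>v. \<not> row_fits A B (pts_above P h) v")
  case False
  then show thesis by (intro that[of "{}"]) auto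
next
  case True
  let ?H = "{h\<in>{m..M}. \<forall>v. \<not> row_fits A B (pts_above P h) v}"
  have "Max ?H \<in> ?H" using True by (intro Max_in) auto
  then obtain S where S: "S \<subseteq> pts_above P (Max ?H)" "card S \<le> 4" "\<And>v. \<not> row_fits A B S v"
    using row_fits_witness[of "pts_above P (Max ?H)" A B] assms by (auto simp: pts_above_def)
  show thesis
  proof (rule that[of S])
    show "S \<subseteq> P" using S by (auto simp: pts_above_def)
    show "card S \<le> 4" by fact
    fix h v assume "m \<le> h" "h \<le> M" "\<forall>v. \<not> row_fits A B (pts_above P h) v"
    then have "h \<le> Max ?H" by (intro Max_ge) auto
    then have "pts_above S h = S" using S(1) by (auto simp: pts_above_def)
    then show "\<not> row_fits A B (pts_above S h) v" using S(3) by simp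
  qed
qed

text \<open>Lowering the line removes points from the bottom row, so here the least infeasible
  height decides.\<close>

lemma pts_below_witness:
  assumes "finite P"
  obtains S where "S \<subseteq> P" "card S \<le> 4"
    "\<And>h v. m \<le> h \<Longrightarrow> h \<le> M \<Longrightarrow> \<forall>v. \<not> row_fits C D (pts_below P h) v \<Longrightarrow> \<not> row_fits C D (pts_below S h) v"
proof (cases "\<exists>h\<in>{m..M}. \<forall>v. \<not> row_fits C D (pts_below P h) v")
  case False
  then show thesis by (intro that[of "{}"]) auto
next
  case True
  let ?H = "{h\<in>{m..M}. \<forall>v. \<not> row_fits C D (pts_below P h) v}"
  have "Min ?H \<in> ?H" using True by (intro Min_in) auto
  then obtain S where S: "S \<subseteq> pts_below P (Min ?H)" "card S \<le> 4" "\<And>v. \<not> row_fits C D S v"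
    using row_fits_witness[of "pts_below P (Min ?H)" C D] assms by (auto simp: pts_below_def)
  show thesis
  proof (rule that[of S])
    show "S \<subseteq> P" using S by (auto simp: pts_below_def)
    show "card S \<le> 4" by fact
    fix h v assume "m \<le> h" "h \<le> M" "\<forall>v. \<not> row_fits C D (pts_below P h) v"
    then have "Min ?H \<le> h" by (intro Min_le) auto
    then have "pts_below S h = S" using S(1) by (auto simp: pts_below_def)
    then show "\<not> row_fits C D (pts_below S h) v" using S(3) by simp
  qed
qed

section \<open>Conflicts between the top right and the bottom left cell\<close>

definition conflict :: "cell \<Rightarrow> cell \<Rightarrow> pt set \<Rightarrow> int \<Rightarrow> int \<Rightarrow> bool" where
  "conflict B C P h w \<longleftrightarrow>
     \<not> good B {p\<in>P. h < snd p \<and> w \<le> fst p} \<and> \<not> good C {p\<in>P. snd p \<le> h \<and> fst p \<le> w}"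

text \<open>Both parts of a conflict include the abscissa \<open>w\<close>: a line with
  \<open>v < w\<close> leaves the whole upper part to its right, any other has the whole lower part
  to its left.\<close>

lemma conflict_not_fits:
  assumes "conflict B C P h w"
  shows "\<not> fits A B C D P v h"
proof (cases "v < w")
  case True
  then have "{p\<in>P. h < snd p \<and> w \<le> fst p} \<subseteq> {p\<in>pts_above P h. v < fst p}" by (auto simp: pts_above_def)
  then show ?thesis using assms good_mono unfolding fits_def row_fits_def conflict_def by blast
next
  case False
  then have "{p\<in>P. snd p \<le> h \<and> fst p \<le> w} \<subseteq> {p\<in>pts_below P h. fst p \<le> v}" by (auto simp: pts_below_def)
  then show ?thesis using assms good_mono unfolding fits_def row_fits_def conflict_def by blast
qed

text \<open>For fixed \<open>w\<close>, an upper obstruction chosen for the greatest height lies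
  above every lower line, and a lower one chosen for the least height lies below every higher
  line.\<close>

lemma conflict_witness:
  assumes "finite P"
  obtains S where "S \<subseteq> P" "card S \<le> 4"
    "\<And>h. hl \<le> h \<Longrightarrow> h \<le> hu \<Longrightarrow> conflict B C P h w \<Longrightarrow> conflict B C S h w"
proof (cases "\<exists>h\<in>{hl..hu}. conflict B C P h w")
  case False
  then show thesis by (intro that[of "{}"]) auto
next
  case True
  let ?H = "{h\<in>{hl..hu}. conflict B C P h w}"
  have mx: "Max ?H \<in> ?H" and mn: "Min ?H \<in> ?H" using True by (intro Max_in Min_in; auto)+
  obtain W1 where W1: "W1 \<subseteq> {p\<in>P. Max ?H < snd p \<and> w \<le> fst p}" "card W1 \<le> 2" "\<not> good B W1"
    using mx not_good_witness[of B "{p\<in>P. Max ?H < snd p \<and> w \<le> fst p}"]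
    unfolding conflict_def by auto
  obtain W2 where W2: "W2 \<subseteq> {p\<in>P. snd p \<le> Min ?H \<and> fst p \<le> w}" "card W2 \<le> 2" "\<not> good C W2"
    using mn not_good_witness[of C "{p\<in>P. snd p \<le> Min ?H \<and> fst p \<le> w}"]
    unfolding conflict_def by auto
  show thesis
  proof (rule that[of "W1 \<union> W2"])
    show "W1 \<union> W2 \<subseteq> P" using W1 W2 by auto
    show "card (W1 \<union> W2) \<le> 4" using card_Un_le[of W1 W2] W1 W2 by linarith
    fix h assume "hl \<le> h" "h \<le> hu" "conflict B C P h w"
    then have "h \<le> Max ?H" "Min ?H \<le> h" by (auto intro!: Max_ge Min_le)
    then have "W1 \<subseteq> {p\<in>W1 \<union> W2. h < snd p \<and> w \<le> fst p}" "W2 \<subseteq> {p\<in>W1 \<union> W2. snd p \<le> h \<and> fst p \<le> w}"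
      using W1(1) W2(1) by force+
    then show "conflict B C (W1 \<union> W2) h w"
      using W1(3) W2(3) good_mono unfolding conflict_def by blast
  qed
qed

text \<open>When the line of the bottom row lies left of that of the top row, only the bottom left
  and the top right cell can obstruct a choice of lines.\<close>

lemma last_conflict:
  assumes top: "row_fits A B (pts_above P hl) vt" and bot: "row_fits C D (pts_below P hu) vb"
    and "vb < vt" and nf: "\<And>v. \<not> fits A B C D P v h" and h: "hl \<le> h" "h \<le> hu"
  obtains w where "conflict B C P h w" "good B {p\<in>P. h < snd p \<and> w + 1 \<le> fst p}"
proof -
  \<comment> \<open>At \<open>h\<close> the top row has no more points than at \<open>hl\<close>,
    and the bottom row no more than at \<open>hu\<close>. Hence \<open>A\<close> is safe up to
    \<open>vt\<close> and \<open>D\<close> from \<open>vb\<close> on.\<close>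
  have gA: "good A {p\<in>pts_above P h. fst p \<le> v}" if "v \<le> vt" for v
    using top h that unfolding row_fits_def pts_above_def by (auto elim!: good_mono)
  have gD: "good D {p\<in>pts_below P h. v < fst p}" if "vb \<le> v" for v
    using bot h that unfolding row_fits_def pts_below_def by (auto elim!: good_mono)
  have "good C {p\<in>pts_below P h. fst p \<le> vb}"
    using bot h unfolding row_fits_def pts_below_def by (auto elim!: good_mono)
  then have a: "\<not> good B {p\<in>pts_above P h. vb < fst p}"
    using nf[of vb] gA[of vb] gD[of vb] \<open>vb < vt\<close> unfolding fits_def row_fits_def by auto
  have b: "\<not> \<not> good B {p\<in>pts_above P h. vt < fst p}"
    using top h unfolding row_fits_def pts_above_def by (auto elim!: good_mono)
  \<comment> \<open>At \<open>v\<close>, \<open>B\<close> fails for the last time before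
    \<open>vt\<close>, and the abscissa sought is \<open>v + 1\<close>: there only \<open>C\<close>
    is left to fail, and no obstruction of \<open>B\<close> lies entirely beyond it.\<close>
  obtain v where v: "vb \<le> v" "v < vt" "\<not> good B {p\<in>pts_above P h. v < fst p}"
      "good B {p\<in>pts_above P h. v + 1 < fst p}"
    using last_int[of "\<lambda>v. \<not> good B {p\<in>pts_above P h. v < fst p}" vb vt, OF a b] \<open>vb < vt\<close> by auto
  have "\<not> good C {p\<in>pts_below P h. fst p \<le> v + 1}"
    using nf[of "v + 1"] gA[of "v + 1"] gD[of "v + 1"] v unfolding fits_def row_fits_def by auto
  moreover have "{p\<in>pts_above P h. v < fst p} = {p\<in>P. h < snd p \<and> v + 1 \<le> fst p}"
    "{p\<in>pts_above P h. v + 1 < fst p} = {p\<in>P. h < snd p \<and> v + 1 + 1 \<le> fst p}"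
    "{p\<in>pts_below P h. fst p \<le> v + 1} = {p\<in>P. snd p \<le> h \<and> fst p \<le> v + 1}"
    by (auto simp: pts_above_def pts_below_def)
  ultimately show thesis using v that[of "v + 1"] unfolding conflict_def by simp
qed

text \<open>Either \<open>c\<close> is constant, or every left end \<open>l h\<close> lies above
  \<open>hu\<close> and \<open>c\<close> has at most one value besides \<open>c hu\<close>. The case
  excluded by \<open>AD\<close> is recovered later by rotation.\<close>

lemma two_abscissae:
  assumes inj: "inj_on fst P" "inj_on snd P"
    and top: "row_fits A B (pts_above P hl) vt" and bot: "row_fits C D (pts_below P hu) vb"
    and "vb < vt" and nf: "\<And>v h. \<not> fits A B C D P v h" and "hl \<le> hu"
    and AD: "D \<noteq> Inc \<or> A = Inc"
  obtains w1 w2 where "\<And>h. hl \<le> h \<Longrightarrow> h \<le> hu \<Longrightarrow> conflict B C P h w1 \<or> conflict B C P h w2"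
proof -
  have "\<exists>w. conflict B C P h w \<and> good B {p\<in>P. h < snd p \<and> w + 1 \<le> fst p}"
    if "hl \<le> h" "h \<le> hu" for h
    using last_conflict[OF top bot \<open>vb < vt\<close> nf that] by blast
  then obtain c where c: "\<And>h. hl \<le> h \<Longrightarrow> h \<le> hu \<Longrightarrow> conflict B C P h (c h)"
    and cmax: "\<And>h. hl \<le> h \<Longrightarrow> h \<le> hu \<Longrightarrow> good B {p\<in>P. h < snd p \<and> c h + 1 \<le> fst p}"
    by metis
  have c_ge: "fst p \<le> c h"
    if "hl \<le> h" "h \<le> hu" "p \<in> P" "q \<in> P" "h < snd p" "h < snd q" "fst p \<le> fst q" "bad B p q"
    for h p q
    using cmax[of h] that unfolding good_def by fastforce
  \<comment> \<open>No obstruction of \<open>B\<close> above \<open>h\<close> starts beyond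
    \<open>c h\<close>, so one starts exactly there. Its ends become \<open>l h\<close> and
    \<open>q h\<close>, which can coincide if \<open>B = Void\<close>.\<close>
  have pair: "\<exists>l q. l \<in> P \<and> q \<in> P \<and> bad B l q \<and> fst l = c h \<and> fst l \<le> fst q \<and> h < snd l \<and> h < snd q"
    if h: "hl \<le> h" "h \<le> hu" for h
  proof -
    obtain l q where "l \<in> {p\<in>P. h < snd p \<and> c h \<le> fst p}" "q \<in> {p\<in>P. h < snd p \<and> c h \<le> fst p}"
      "bad B l q" "fst l \<le> fst q"
      using c[OF h] unfolding conflict_def by (auto elim!: not_goodE)
    moreover from this have "fst l = c h" using c_ge[of h l q] h by auto
    ultimately show ?thesis by blast
  qed
  then obtain l q where lq: "\<And>h. hl \<le> h \<Longrightarrow> h \<le> hu \<Longrightarrow> l h \<in> P \<and> q h \<in> P \<and> bad B (l h) (q h) \<and>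
      fst (l h) = c h \<and> fst (l h) \<le> fst (q h) \<and> h < snd (l h) \<and> h < snd (q h)"
    by metis
  have topA: "\<not> bad A x y"
    if "x \<in> P" "y \<in> P" "hl < snd x" "hl < snd y" "fst x \<le> vt" "fst y \<le> vt" for x y
    using top that unfolding row_fits_def good_def pts_above_def by blast
  have botD: "\<not> bad D x y"
    if "x \<in> P" "y \<in> P" "snd x \<le> hu" "snd y \<le> hu" "vb < fst x" "vb < fst y" for x y
    using bot that unfolding row_fits_def good_def pts_below_def by blast
  have l_le: "fst (l h) \<le> vt" if h: "hl \<le> h" "h \<le> hu" for h
  proof (rule ccontr)
    assume "\<not> fst (l h) \<le> vt"
    then have "l h \<in> {p\<in>pts_above P hl. vt < fst p}" "q h \<in> {p\<in>pts_above P hl. vt < fst p}"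
      using lq[OF h] h by (auto simp: pts_above_def)
    then show False using top lq[OF h] unfolding row_fits_def good_def by blast
  qed
  \<comment> \<open>An obstruction of \<open>C\<close> must reach beyond \<open>vb\<close>, since
    \<open>C\<close> is good up to there. Its right end and \<open>l h\<close> form the increasing
    pair that restricts \<open>D\<close>.\<close>
  have r: "\<exists>r\<in>P. vb < fst r \<and> fst r \<le> fst (l h) \<and> snd r \<le> h" if h: "hl \<le> h" "h \<le> hu" for h
  proof -
    obtain e r where er: "e \<in> {p\<in>P. snd p \<le> h \<and> fst p \<le> c h}" "r \<in> {p\<in>P. snd p \<le> h \<and> fst p \<le> c h}"
      "bad C e r" "fst e \<le> fst r"
      using c[OF h] unfolding conflict_def by (auto elim!: not_goodE)
    have "vb < fst r"
    proof (rule ccontr)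
      assume "\<not> vb < fst r"
      then have "e \<in> {p\<in>pts_below P hu. fst p \<le> vb}" "r \<in> {p\<in>pts_below P hu. fst p \<le> vb}"
        using er h by (auto simp: pts_below_def)
      then show False using bot er unfolding row_fits_def good_def by blast
    qed
    then show ?thesis using er lq[OF h] by auto
  qed
  \<comment> \<open>Otherwise this increasing pair would lie in the bottom right cell cut out by
    \<open>vb\<close> and \<open>hu\<close>.\<close>
  have l_high: "hu < snd (l h)" if h: "hl \<le> h" "h \<le> hu" and "D \<noteq> Inc" for h
  proof (rule ccontr)
    assume low: "\<not> hu < snd (l h)"
    obtain r where r: "r \<in> P" "vb < fst r" "fst r \<le> fst (l h)" "snd r \<le> h" using r[OF h] by blast
    then have "fst r \<noteq> fst (l h)" using inj lq[OF h] unfolding inj_on_def by force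
    then have "fst r < fst (l h)" "snd r < snd (l h)" using r lq[OF h] by auto
    moreover have "\<not> bad D r (l h)" using botD[of r "l h"] r lq[OF h] h low by auto
    ultimately show False using \<open>D \<noteq> Inc\<close> by (cases D) auto
  qed
  show thesis
  proof (cases "A = Inc \<and> B \<noteq> Inc")
    case True
    \<comment> \<open>Here \<open>c\<close> is constant: all left ends lie in the top left cell cut
      out by \<open>vt\<close> and \<open>hl\<close>, so they increase.\<close>
    have "conflict B C P h (c hl)" if h: "hl \<le> h" "h \<le> hu" for h
    proof -
      have hl: "hl \<le> hl" by simp
      note L = lq[OF hl \<open>hl \<le> hu\<close>] lq[OF h] l_le[OF hl \<open>hl \<le> hu\<close>] l_le[OF h]
      have le: "c h \<le> c hl" using c_ge[of hl "l h" "q h"] L h by auto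
      moreover have "c hl \<le> c h"
      proof (rule ccontr)
        assume "\<not> c hl \<le> c h"
        then have "fst (l h) < fst (l hl)" using L by auto
        moreover have "\<not> bad A (l h) (l hl)" using topA L h by auto
        ultimately have y: "snd (l h) \<le> snd (l hl)" using True by auto
        \<comment> \<open>Being further right, \<open>l hl\<close> is not below \<open>l h\<close>
          and thus lies above \<open>h\<close>. So does the obstruction of \<open>B\<close> that it
          starts, against the maximality of \<open>c h\<close>.\<close>
        show False
        proof (cases B)
          case Inc then show False using True by simp
        next
          case Dec
          then show False using c_ge[of h "l hl" "q hl"] L h y \<open>\<not> c hl \<le> c h\<close> by auto
        next
          case Void
          then show False using c_ge[of h "l hl" "l hl"] L h y \<open>\<not> c hl \<le> c h\<close> by auto
        qed
      qed
      ultimately have "c hl = c h" by simp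
      then show ?thesis using c[OF h] by simp
    qed
    then show thesis using that by blast
  next
    case False
    \<comment> \<open>If \<open>D = Inc\<close>, then \<open>A\<close> and \<open>B\<close> are
      \<open>Inc\<close> too, so \<open>q h\<close> is below \<open>l h\<close>; a low
      \<open>l h\<close> would put a decreasing pair in the bottom right cell.\<close>
    have high: "hu < snd (l h)" if h: "hl \<le> h" "h \<le> hu" for h
    proof (cases "D = Inc")
      case False
      then show ?thesis using l_high h by blast
    next
      case True
      then have AB: "A = Inc" "B = Inc" using AD False by auto
      note L = lq[OF h] l_le[OF h] r[OF h]
      show ?thesis
      proof (rule ccontr)
        assume "\<not> hu < snd (l h)"
        moreover have "snd (q h) < snd (l h)" using L AB by auto
        ultimately have "\<not> bad D (l h) (q h)" using botD[of "l h" "q h"] L by force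
        then show False using L AB True by auto
      qed
    qed
    have chu: "c hu \<le> c h" if h: "hl \<le> h" "h \<le> hu" for h
      using c_ge[of h "l hu" "q hu"] lq[of hu] h by auto
    let ?K = "{h\<in>{hl..hu}. c h \<noteq> c hu}"
    show thesis
    proof (cases "\<forall>h\<in>{hl..hu}. c h = c hu")
      case True
      have "conflict B C P h (c hu)" if h: "hl \<le> h" "h \<le> hu" for h
      proof -
        have "c h = c hu" using bspec[OF True, of h] h by simp
        then show ?thesis using c[OF h] by simp
      qed
      then show thesis using that by blast
    next
      case False
      then have "?K \<noteq> {}" by blast
      have "finite ?K" by simp
      \<comment> \<open>The greatest height at which \<open>c\<close> differs from its least value
        \<open>c hu\<close>; its value turns out to be shared by all such heights.\<close>
      define g where "g = Max ?K"
      have "g \<in> ?K" unfolding g_def using Max_in[OF \<open>finite ?K\<close> \<open>?K \<noteq> {}\<close>] .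
      then have g: "hl \<le> g" "g \<le> hu" "c g \<noteq> c hu" by auto
      note G = lq[OF g(1,2)] l_le[OF g(1,2)] high[OF g(1,2)]
      \<comment> \<open>An obstruction starting right of \<open>c hu\<close> cannot lie wholly above
        \<open>hu\<close>. As \<open>l g\<close> does, \<open>q g\<close> does not, which forces
        \<open>B = Inc\<close>.\<close>
      have key: "\<not> (hu < snd (q g))"
        using c_ge[of hu "l g" "q g"] G chu[OF g(1,2)] g \<open>hl \<le> hu\<close> by force
      have B: "B = Inc"
      proof (cases B)
        case Void
        then show ?thesis using c_ge[of hu "l g" "l g"] G chu[OF g(1,2)] g \<open>hl \<le> hu\<close> by force
      next
        case Dec
        then show ?thesis using G key by auto
      qed simp
      have "conflict B C P h (c g)" if h: "hl \<le> h" "h \<le> hu" "c h \<noteq> c hu" for h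
      proof -
        have "h \<le> g" unfolding g_def using h by (intro Max_ge) auto
        note L = lq[OF h(1,2)] l_le[OF h(1,2)] high[OF h(1,2)]
        \<comment> \<open>Otherwise \<open>q g\<close> is left of \<open>vt\<close> as well. The
          increasing pair \<open>q g\<close>, \<open>l h\<close> then forces \<open>A = Inc\<close>,
          which the decreasing pair \<open>l g\<close>, \<open>q g\<close> contradicts.\<close>
        have x: "fst (l h) < fst (q g)"
        proof (rule ccontr)
          assume n: "\<not> fst (l h) < fst (q g)"
          then have "fst (q g) \<le> vt" using L by auto
          then have nb: "\<not> bad A (q g) (l h)" "\<not> bad A (l g) (q g)"
            using topA[of "q g" "l h"] topA[of "l g" "q g"] L G h g by auto
          have "snd (q g) < snd (l h)" using key L by auto
          moreover from this have "fst (q g) \<noteq> fst (l h)"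
            using inj L G unfolding inj_on_def by (metis less_irrefl)
          ultimately have "A = Inc" using nb n by (cases A) auto
          then show False using nb G B by auto
        qed
        \<comment> \<open>Since \<open>l h\<close> is above \<open>hu\<close> and \<open>q g\<close>
          is not, these two form a decreasing pair above \<open>g\<close>, starting at
          \<open>c h\<close>.\<close>
        have "c h \<le> c g"
          using c_ge[of g "l h" "q g"] L G key g B x by auto
        moreover have "c g \<le> c h"
          using c_ge[of h "l g" "q g"] G h \<open>h \<le> g\<close> by auto
        ultimately have "c g = c h" by simp
        then show ?thesis using c h by simp
      qed
      then show thesis using that c by metis
    qed
  qed
qed

subsection \<open>Reflections, and the bound for point sets\<close>

lemma strip_witness_oriented:
  assumes fin: "finite P" and inj: "inj_on fst P" "inj_on snd P"
    and top: "row_fits A B (pts_above P hl) vt" and bot: "row_fits C D (pts_below P hu) vb"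
    and "vb < vt" and nf: "\<And>v h. \<not> fits A B C D P v h" and "hl \<le> hu"
    and AD: "D \<noteq> Inc \<or> A = Inc"
  shows "\<exists>S\<subseteq>P. card S \<le> 8 \<and> (\<forall>h\<in>{hl..hu}. \<forall>v. \<not> fits A B C D S v h)"
proof -
  obtain w1 w2 where w: "\<And>h. hl \<le> h \<Longrightarrow> h \<le> hu \<Longrightarrow> conflict B C P h w1 \<or> conflict B C P h w2"
    using two_abscissae[OF inj top bot \<open>vb < vt\<close> nf \<open>hl \<le> hu\<close> AD] by blast
  obtain S1 where S1: "S1 \<subseteq> P" "card S1 \<le> 4"
    "\<And>h. hl \<le> h \<Longrightarrow> h \<le> hu \<Longrightarrow> conflict B C P h w1 \<Longrightarrow> conflict B C S1 h w1"
    using conflict_witness[OF fin, of hl hu B C w1] by blast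
  obtain S2 where S2: "S2 \<subseteq> P" "card S2 \<le> 4"
    "\<And>h. hl \<le> h \<Longrightarrow> h \<le> hu \<Longrightarrow> conflict B C P h w2 \<Longrightarrow> conflict B C S2 h w2"
    using conflict_witness[OF fin, of hl hu B C w2] by blast
  have "\<not> fits A B C D (S1 \<union> S2) v h" if "h \<in> {hl..hu}" for v h
  proof -
    have "\<not> fits A B C D S1 v h \<or> \<not> fits A B C D S2 v h"
      using w[of h] S1(3)[of h] S2(3)[of h] that conflict_not_fits by (meson atLeastAtMost_iff)
    then show ?thesis using fits_mono by (meson Un_upper1 Un_upper2)
  qed
  moreover have "card (S1 \<union> S2) \<le> 8" using card_Un_le[of S1 S2] S1 S2 by linarith
  ultimately show ?thesis using S1(1) S2(1) by (intro exI[of _ "S1 \<union> S2"]) auto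
qed

section \<open>Effect of rotation and reflection\<close>

lemma good_image:
  assumes "\<And>p q. p \<in> S \<Longrightarrow> q \<in> S \<Longrightarrow> bad T' (f p) (f q) \<longleftrightarrow> bad T p q"
  shows "good T' (f ` S) \<longleftrightarrow> good T S"
  using assms unfolding good_def by simp

text \<open>A point on a line counts as left of it or below it, hence the shift by one when the
  lines are reflected.\<close>

definition rotate_pt :: "pt \<Rightarrow> pt" where
  "rotate_pt p = (- fst p, - snd p)"

definition mirror_pt :: "pt \<Rightarrow> pt" where
  "mirror_pt p = (- fst p, snd p)"

fun mirror_cell :: "cell \<Rightarrow> cell" where
  "mirror_cell Inc = Dec"
| "mirror_cell Dec = Inc"
| "mirror_cell Void = Void"

lemma row_fits_rotate: "row_fits A B (rotate_pt ` P) (- v - 1) \<longleftrightarrow> row_fits B A P v"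
proof -
  have "{p\<in>rotate_pt ` P. fst p \<le> - v - 1} = rotate_pt ` {p\<in>P. v < fst p}"
    "{p\<in>rotate_pt ` P. - v - 1 < fst p} = rotate_pt ` {p\<in>P. fst p \<le> v}"
    by (auto simp: rotate_pt_def)
  moreover have "bad T (rotate_pt p) (rotate_pt q) = bad T p q" for T p q
    by (cases T) (auto simp: rotate_pt_def)
  ultimately show ?thesis unfolding row_fits_def by (simp add: good_image conj_commute)
qed

lemma row_fits_mirror: "row_fits (mirror_cell A) (mirror_cell B) (mirror_pt ` P) (- v - 1) \<longleftrightarrow> row_fits B A P v"
proof -
  have "{p\<in>mirror_pt ` P. fst p \<le> - v - 1} = mirror_pt ` {p\<in>P. v < fst p}"
    "{p\<in>mirror_pt ` P. - v - 1 < fst p} = mirror_pt ` {p\<in>P. fst p \<le> v}"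
    by (auto simp: mirror_pt_def)
  moreover have "bad (mirror_cell T) (mirror_pt p) (mirror_pt q) = bad T p q" for T p q
    by (cases T) (auto simp: mirror_pt_def)
  ultimately show ?thesis unfolding row_fits_def by (simp add: good_image conj_commute)
qed

lemma pts_above_rotate: "pts_above (rotate_pt ` P) (- h - 1) = rotate_pt ` pts_below P h"
  and pts_below_rotate: "pts_below (rotate_pt ` P) (- h - 1) = rotate_pt ` pts_above P h"
  and pts_above_mirror: "pts_above (mirror_pt ` P) h = mirror_pt ` pts_above P h"
  and pts_below_mirror: "pts_below (mirror_pt ` P) h = mirror_pt ` pts_below P h"
  by (auto simp: pts_above_def pts_below_def rotate_pt_def mirror_pt_def)

lemma fits_rotate: "fits A B C D (rotate_pt ` P) (- v - 1) (- h - 1) \<longleftrightarrow> fits D C B A P v h"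
  by (auto simp: fits_def pts_above_rotate pts_below_rotate row_fits_rotate)

lemma fits_mirror:
  "fits (mirror_cell A) (mirror_cell B) (mirror_cell C) (mirror_cell D) (mirror_pt ` P) (- v - 1) h \<longleftrightarrow>
    fits B A D C P v h"
  by (auto simp: fits_def pts_above_mirror pts_below_mirror row_fits_mirror)

lemma subset_imageE:
  assumes "S \<subseteq> f ` P" "inj f"
  obtains S' where "S' \<subseteq> P" "S = f ` S'" "card S = card S'"
  using assms by (metis subset_image_iff card_image inj_on_subset subset_UNIV)

lemma inj_rotate_pt: "inj rotate_pt" and inj_mirror_pt: "inj mirror_pt"
  by (auto simp: inj_def rotate_pt_def mirror_pt_def prod_eq_iff)

lemma inj_on_coordinates:
  assumes "inj_on fst P" "inj_on snd P"
  shows "inj_on fst (rotate_pt ` P)" "inj_on snd (rotate_pt ` P)"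
    "inj_on fst (mirror_pt ` P)" "inj_on snd (mirror_pt ` P)"
  using assms by (auto simp: inj_on_def rotate_pt_def mirror_pt_def)

text \<open>If the condition \<open>AD\<close> fails, then \<open>A \<noteq> Inc\<close>, and
  rotation puts \<open>A\<close> in the place of \<open>D\<close>. Rotation exchanges the rows and
  reverses abscissae, so the line of the bottom row stays on the left.\<close>

lemma strip_witness_left:
  assumes fin: "finite P" and inj: "inj_on fst P" "inj_on snd P"
    and top: "row_fits A B (pts_above P hl) vt" and bot: "row_fits C D (pts_below P hu) vb"
    and "vb < vt" and nf: "\<And>v h. \<not> fits A B C D P v h" and "hl \<le> hu"
  shows "\<exists>S\<subseteq>P. card S \<le> 8 \<and> (\<forall>h\<in>{hl..hu}. \<forall>v. \<not> fits A B C D S v h)"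
proof (cases "D \<noteq> Inc \<or> A = Inc")
  case True
  then show ?thesis by (rule strip_witness_oriented[OF assms])
next
  case False
  have "\<exists>S\<subseteq>rotate_pt ` P. card S \<le> 8 \<and> (\<forall>h\<in>{- hu - 1..- hl - 1}. \<forall>v. \<not> fits D C B A S v h)"
  proof (rule strip_witness_oriented)
    show "row_fits D C (pts_above (rotate_pt ` P) (- hu - 1)) (- vb - 1)"
      using bot by (simp only: pts_above_rotate row_fits_rotate)
    show "row_fits B A (pts_below (rotate_pt ` P) (- hl - 1)) (- vt - 1)"
      using top by (simp only: pts_below_rotate row_fits_rotate)
    show "\<not> fits D C B A (rotate_pt ` P) v h" for v h
      using nf[of "- v - 1" "- h - 1"] fits_rotate[of D C B A P "- v - 1" "- h - 1"] by simp
  qed (use False fin inj_on_coordinates[OF inj] \<open>vb < vt\<close> \<open>hl \<le> hu\<close> in auto)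
  then obtain S where S: "S \<subseteq> rotate_pt ` P" "card S \<le> 8"
    "\<And>h v. h \<in> {- hu - 1..- hl - 1} \<Longrightarrow> \<not> fits D C B A S v h" by blast
  obtain S' where S': "S' \<subseteq> P" "S = rotate_pt ` S'" "card S = card S'"
    using subset_imageE[OF S(1) inj_rotate_pt] by blast
  have "\<not> fits A B C D S' v h" if "h \<in> {hl..hu}" for v h
    using S(3)[of "- h - 1" "- v - 1"] that unfolding S'(2) fits_rotate by simp
  then show ?thesis using S S' by auto
qed

text \<open>If \<open>vt = vb\<close>, this line would suit both rows at height \<open>hl\<close>.
  The order \<open>vt < vb\<close> becomes the other one by reflection.\<close>

lemma strip_witness:
  assumes fin: "finite P" and inj: "inj_on fst P" "inj_on snd P"
    and top: "row_fits A B (pts_above P hl) vt" and bot: "row_fits C D (pts_below P hu) vb"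
    and nf: "\<And>v h. \<not> fits A B C D P v h" and "hl \<le> hu"
  shows "\<exists>S\<subseteq>P. card S \<le> 8 \<and> (\<forall>h\<in>{hl..hu}. \<forall>v. \<not> fits A B C D S v h)"
proof -
  have "pts_below P hl \<subseteq> pts_below P hu" using \<open>hl \<le> hu\<close> by (intro pts_below_mono) auto
  then have "row_fits C D (pts_below P hl) vb" using bot row_fits_mono by blast
  then have "vt \<noteq> vb" using top nf[of vt hl] unfolding fits_def by blast
  then consider "vb < vt" | "vt < vb" by linarith
  then show ?thesis
  proof cases
    case 1
    show ?thesis by (rule strip_witness_left[OF fin inj top bot 1 nf \<open>hl \<le> hu\<close>])
  next
    case 2
    let ?A = "mirror_cell B" and ?B = "mirror_cell A" and ?C = "mirror_cell D" and ?D = "mirror_cell C"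
    have "\<exists>S\<subseteq>mirror_pt ` P. card S \<le> 8 \<and> (\<forall>h\<in>{hl..hu}. \<forall>v. \<not> fits ?A ?B ?C ?D S v h)"
    proof (rule strip_witness_left)
      show "row_fits ?A ?B (pts_above (mirror_pt ` P) hl) (- vt - 1)"
        using top by (simp only: pts_above_mirror row_fits_mirror)
      show "row_fits ?C ?D (pts_below (mirror_pt ` P) hu) (- vb - 1)"
        using bot by (simp only: pts_below_mirror row_fits_mirror)
      show "\<not> fits ?A ?B ?C ?D (mirror_pt ` P) v h" for v h
        using nf[of "- v - 1" h] fits_mirror[of B A D C P "- v - 1" h] by simp
    qed (use fin inj_on_coordinates[OF inj] \<open>vt < vb\<close> \<open>hl \<le> hu\<close> in auto)
    then obtain S where S: "S \<subseteq> mirror_pt ` P" "card S \<le> 8"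
      "\<And>h v. h \<in> {hl..hu} \<Longrightarrow> \<not> fits ?A ?B ?C ?D S v h" by blast
    obtain S' where S': "S' \<subseteq> P" "S = mirror_pt ` S'" "card S = card S'"
      using subset_imageE[OF S(1) inj_mirror_pt] by blast
    have "\<not> fits A B C D S' v h" if "h \<in> {hl..hu}" for v h
      using S(3)[of h "- v - 1"] that unfolding S'(2) fits_mirror by simp
    then show ?thesis using S S' by auto
  qed
qed

section \<open>Sixteen points that exclude all pairs of lines\<close>

lemma fits_witness:
  assumes fin: "finite P" and inj: "inj_on fst P" "inj_on snd P"
    and nf: "\<And>v h. \<not> fits A B C D P v h"
  shows "\<exists>S\<subseteq>P. card S \<le> 16 \<and> (\<forall>v h. \<not> fits A B C D S v h)"
proof -
  obtain m M where mM: "m \<le> M" "\<And>p. p \<in> P \<Longrightarrow> m < snd p \<and> snd p \<le> M"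
    using finite_int_bounds[OF fin, of snd] by blast
  define T where "T = (\<lambda>h. \<exists>v. row_fits A B (pts_above P h) v)"
  define Bt where "Bt = (\<lambda>h. \<exists>v. row_fits C D (pts_below P h) v)"
  have Tmono: "T h'" if "T h" "h \<le> h'" for h h'
    using that row_fits_mono pts_above_mono[of P P] unfolding T_def by blast
  have Bmono: "Bt h" if "Bt h'" "h \<le> h'" for h h'
    using that row_fits_mono pts_below_mono[of P P] unfolding Bt_def by blast
  \<comment> \<open>\<open>S1\<close> handles the heights where no line suits the top row,
    \<open>S2\<close> those where none suits the bottom row, and \<open>S3\<close> below the heights
    where each row has a line of its own.\<close>
  obtain S1 where S1: "S1 \<subseteq> P" "card S1 \<le> 4"
    "\<And>h v. m \<le> h \<Longrightarrow> h \<le> M \<Longrightarrow> \<not> T h \<Longrightarrow> \<not> row_fits A B (pts_above S1 h) v"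
    using pts_above_witness[OF fin, of m M A B] unfolding T_def by metis
  obtain S2 where S2: "S2 \<subseteq> P" "card S2 \<le> 4"
    "\<And>h v. m \<le> h \<Longrightarrow> h \<le> M \<Longrightarrow> \<not> Bt h \<Longrightarrow> \<not> row_fits C D (pts_below S2 h) v"
    using pts_below_witness[OF fin, of m M C D] unfolding Bt_def by metis
  let ?H = "{h\<in>{m..M}. T h \<and> Bt h}"
  have "\<exists>S\<subseteq>P. card S \<le> 8 \<and> (\<forall>h\<in>?H. \<forall>v. \<not> fits A B C D S v h)"
  proof (cases "?H = {}")
    case True
    then show ?thesis by (intro exI[of _ "{}"]) auto
  next
    case False
    have "finite ?H" by simp
    define hl hu where "hl = Min ?H" and "hu = Max ?H"
    have H: "?H \<subseteq> {hl..hu}" unfolding hl_def hu_def using \<open>finite ?H\<close> by (auto simp del: finite_Collect_conjI)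
    have "hl \<in> ?H" "hu \<in> ?H"
      unfolding hl_def hu_def using Min_in[OF \<open>finite ?H\<close> False] Max_in[OF \<open>finite ?H\<close> False] by blast+
    \<comment> \<open>Among these heights the top row has most points at \<open>hl\<close> and the
      bottom row at \<open>hu\<close>.\<close>
    then obtain vt vb where "row_fits A B (pts_above P hl) vt" "row_fits C D (pts_below P hu) vb" "hl \<le> hu"
      using H unfolding T_def Bt_def by auto
    from strip_witness[OF fin inj this(1,2) nf this(3)] show ?thesis using H by blast
  qed
  then obtain S3 where S3: "S3 \<subseteq> P" "card S3 \<le> 8"
    "\<And>h v. h \<in> ?H \<Longrightarrow> \<not> fits A B C D S3 v h" by blast
  let ?S = "S1 \<union> S2 \<union> S3"
  have SP: "?S \<subseteq> P" using S1 S2 S3 by blast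
  have "\<not> fits A B C D ?S v h" for v h
  proof
    assume fit: "fits A B C D ?S v h"
    \<comment> \<open>All ordinates lie above \<open>m\<close> and at most at \<open>M\<close>, so
      moving \<open>h\<close> into the range changes neither row.\<close>
    let ?h = "max m (min M h)"
    have "pts_above ?S h = pts_above ?S ?h" "pts_below ?S h = pts_below ?S ?h"
      using SP mM unfolding pts_above_def pts_below_def by force+
    then have fit': "fits A B C D ?S v ?h" using fit unfolding fits_def by simp
    have h: "m \<le> ?h" "?h \<le> M" using mM(1) by auto
    have "fits A B C D S1 v ?h" "fits A B C D S2 v ?h" "fits A B C D S3 v ?h"
      using fits_mono[OF fit'] by blast+
    then show False
      using S1(3)[OF h] S2(3)[OF h] S3(3)[of ?h] h unfolding fits_def by (cases "T ?h \<and> Bt ?h") auto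
  qed
  moreover have "card ?S \<le> 16"
    using card_Un_le[of S1 S2] card_Un_le[of "S1 \<union> S2" S3] S1 S2 S3 by linarith
  ultimately show ?thesis using SP by (intro exI[of _ ?S]) auto
qed

subsection \<open>Permutations as point sets\<close>

lemma threshold_transfer:
  fixes f g :: "'a \<Rightarrow> int"
  assumes "finite I" "\<And>i j. i \<in> I \<Longrightarrow> j \<in> I \<Longrightarrow> f i < f j \<longleftrightarrow> g i < g j"
  obtains v' where "\<And>i. i \<in> I \<Longrightarrow> f i \<le> v' \<longleftrightarrow> g i \<le> v"
proof (cases "\<exists>i\<in>I. g i \<le> v")
  case True
  \<comment> \<open>The new threshold is the greatest \<open>f\<close>-value among the indices that
    \<open>g\<close> puts below the old one; if there is none, a bound below all
    \<open>f\<close>-values serves.\<close>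
  let ?J = "{i\<in>I. g i \<le> v}"
  have J: "finite (f ` ?J)" "f ` ?J \<noteq> {}" using assms(1) True by auto
  obtain j where "Max (f ` ?J) = f j" "j \<in> ?J" using Max_in[OF J] by (rule imageE)
  then have j: "j \<in> I" "g j \<le> v" "Max (f ` ?J) = f j" by blast+
  show thesis
  proof (rule that)
    fix i assume i: "i \<in> I"
    have "f i \<le> f j \<longleftrightarrow> g i \<le> g j" using assms(2) i j by (meson not_le)
    moreover have "f i \<le> f j" if "g i \<le> v"
      unfolding j(3)[symmetric] using J i that by (intro Max_ge) auto
    ultimately show "f i \<le> f j \<longleftrightarrow> g i \<le> v" using j(2) by linarith
  qed
next
  case False
  obtain m M where "m \<le> M" "\<And>i. i \<in> I \<Longrightarrow> m < f i \<and> f i \<le> M"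
    using finite_int_bounds[OF assms(1), of f] by blast
  then show thesis using False by (intro that[of m]) force
qed

text \<open>In this form each line enters only through comparisons \<open>\<le>\<close> with points,
  which can be rewritten one by one.\<close>

lemma fits_iff:
  "fits A B C D P v h \<longleftrightarrow> (\<forall>p\<in>P. \<forall>q\<in>P.
     \<not> (bad A p q \<and> fst p \<le> v \<and> fst q \<le> v \<and> \<not> snd p \<le> h \<and> \<not> snd q \<le> h) \<and>
     \<not> (bad B p q \<and> \<not> fst p \<le> v \<and> \<not> fst q \<le> v \<and> \<not> snd p \<le> h \<and> \<not> snd q \<le> h) \<and>
     \<not> (bad C p q \<and> fst p \<le> v \<and> fst q \<le> v \<and> snd p \<le> h \<and> snd q \<le> h) \<and>
     \<not> (bad D p q \<and> \<not> fst p \<le> v \<and> \<not> fst q \<le> v \<and> snd p \<le> h \<and> snd q \<le> h))"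
  unfolding fits_def row_fits_def good_def pts_above_def pts_below_def not_le by blast

lemma fits_transfer:
  assumes fin: "finite I"
    and x: "\<And>i j. i \<in> I \<Longrightarrow> j \<in> I \<Longrightarrow> fst (F i) < fst (F j) \<longleftrightarrow> fst (G i) < fst (G j)"
    and y: "\<And>i j. i \<in> I \<Longrightarrow> j \<in> I \<Longrightarrow> snd (F i) < snd (F j) \<longleftrightarrow> snd (G i) < snd (G j)"
    and "fits A B C D (G ` I) v h"
  shows "\<exists>v' h'. fits A B C D (F ` I) v' h'"
proof -
  obtain v' where v': "\<And>i. i \<in> I \<Longrightarrow> fst (F i) \<le> v' \<longleftrightarrow> fst (G i) \<le> v"
    using threshold_transfer[OF fin, of "\<lambda>i. fst (F i)" "\<lambda>i. fst (G i)"] x by blast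
  obtain h' where h': "\<And>i. i \<in> I \<Longrightarrow> snd (F i) \<le> h' \<longleftrightarrow> snd (G i) \<le> h"
    using threshold_transfer[OF fin, of "\<lambda>i. snd (F i)" "\<lambda>i. snd (G i)"] y by blast
  have bad: "bad T (F i) (F j) \<longleftrightarrow> bad T (G i) (G j)" if "i \<in> I" "j \<in> I" for T i j
    using x y that by (cases T) auto
  then have "fits A B C D (F ` I) v' h'"
    unfolding fits_iff
  proof (intro ballI)
    fix p q assume "p \<in> F ` I" "q \<in> F ` I"
    then obtain i j where ij: "p = F i" "q = F j" "i \<in> I" "j \<in> I" by blast
    show "\<not> (bad A p q \<and> fst p \<le> v' \<and> fst q \<le> v' \<and> \<not> snd p \<le> h' \<and> \<not> snd q \<le> h') \<and>
      \<not> (bad B p q \<and> \<not> fst p \<le> v' \<and> \<not> fst q \<le> v' \<and> \<not> snd p \<le> h' \<and> \<not> snd q \<le> h') \<and>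
      \<not> (bad C p q \<and> fst p \<le> v' \<and> fst q \<le> v' \<and> snd p \<le> h' \<and> snd q \<le> h') \<and>
      \<not> (bad D p q \<and> \<not> fst p \<le> v' \<and> \<not> fst q \<le> v' \<and> snd p \<le> h' \<and> snd q \<le> h')"
      unfolding ij(1,2) bad[OF ij(3,4)] v'[OF ij(3)] v'[OF ij(4)] h'[OF ij(3)] h'[OF ij(4)]
      using assms(4)[unfolded fits_iff, THEN bspec, THEN bspec, OF imageI imageI, OF ij(3,4)] .
  qed
  then show ?thesis by blast
qed

section \<open>Sublists, patterns of length two and standardization\<close>

lemma nths_eq_map_filter: "nths xs K = map ((!) xs) (filter (\<lambda>k. k \<in> K) [0..<length xs])"
proof (induction xs rule: rev_induct)
  case (snoc x xs)
  have "map ((!) xs) (filter (\<lambda>k. k \<in> K) [0..<length xs]) =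
      map ((!) (xs @ [x])) (filter (\<lambda>k. k \<in> K) [0..<length xs])"
    by (auto simp: nth_append)
  then show ?case using snoc by (simp add: nths_append)
qed simp

lemma sorted_wrt_filter_upt:
  "sorted_wrt Q (filter P [0..<n]) \<longleftrightarrow> (\<forall>k l. k < l \<and> l < n \<and> P k \<and> P l \<longrightarrow> Q k l)"
  by (induction n) (auto simp: sorted_wrt_append less_Suc_eq)

text \<open>Turns containment of a pattern of length two into a failure of sortedness.\<close>

lemma ex_subseq_pair_iff:
  "(\<exists>x y. subseq [x, y] xs \<and> R x y) \<longleftrightarrow> \<not> sorted_wrt (\<lambda>x y. \<not> R x y) xs"
proof (induction xs)
  case (Cons a xs)
  have "subseq [x, y] (a # xs) \<longleftrightarrow> (x = a \<and> y \<in> set xs) \<or> subseq [x, y] xs" for x y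
    by (auto simp: subseq_singleton_left dest: subseq_Cons')
  then show ?case using Cons by auto
qed simp

lemma order_iso_pair:
  "order_iso \<tau> [1, 2] \<longleftrightarrow> (\<exists>x y. \<tau> = [x, y] \<and> x < y)"
  "order_iso \<tau> [2, 1] \<longleftrightarrow> (\<exists>x y. \<tau> = [x, y] \<and> y < x)"
  unfolding order_iso_def by (auto simp: length_Suc_conv less_Suc_eq eval_nat_numeral)

lemma contained_12: "[1, 2] \<preceq> \<pi> \<longleftrightarrow> \<not> sorted_wrt (\<lambda>x y. \<not> x < y) \<pi>"
  unfolding contained_def order_iso_pair ex_subseq_pair_iff[symmetric] by blast

lemma contained_21: "[2, 1] \<preceq> \<pi> \<longleftrightarrow> \<not> sorted_wrt (\<lambda>x y. \<not> y < x) \<pi>"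
  unfolding contained_def order_iso_pair ex_subseq_pair_iff[symmetric] by blast

lemma is_perm_iff: "is_perm \<pi> \<longleftrightarrow> set \<pi> = {1..length \<pi>} \<and> distinct \<pi>"
  unfolding is_perm_def permutations_of_set_def by auto

lemma order_iso_sorted_wrt:
  assumes "order_iso xs ys"
  shows "sorted_wrt (\<lambda>x y. \<not> x < y) xs \<longleftrightarrow> sorted_wrt (\<lambda>x y. \<not> x < y) ys"
    "sorted_wrt (\<lambda>x y. \<not> y < x) xs \<longleftrightarrow> sorted_wrt (\<lambda>x y. \<not> y < x) ys"
  using assms unfolding order_iso_def sorted_wrt_iff_nth_less by (metis order.strict_trans)+

lemma standardization_exists:
  assumes "distinct xs"
  obtains \<sigma> where "is_perm \<sigma>" "order_iso xs \<sigma>"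
proof -
  \<comment> \<open>Counting \<open>x\<close> itself makes the ranks start at 1.\<close>
  define rank where "rank x = card {y\<in>set xs. y \<le> x}" for x
  have less: "rank x < rank y" if "x < y" "y \<in> set xs" for x y
  proof -
    have "y \<in> {z\<in>set xs. z \<le> y} - {z\<in>set xs. z \<le> x}" "{z\<in>set xs. z \<le> x} \<subseteq> {z\<in>set xs. z \<le> y}"
      using that by auto
    then show ?thesis unfolding rank_def by (intro psubset_card_mono) auto
  qed
  then have iff: "rank x < rank y \<longleftrightarrow> x < y" if "x \<in> set xs" "y \<in> set xs" for x y
    using that by (metis less_asym' less_irrefl linorder_neqE_nat)
  have inj: "inj_on rank (set xs)"
    using less unfolding inj_on_def by (metis less_irrefl linorder_neqE_nat)
  have "rank ` set xs \<subseteq> {1..length xs}"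
  proof
    fix r assume "r \<in> rank ` set xs"
    then obtain x where x: "x \<in> set xs" "r = rank x" by blast
    have "rank x \<le> card (set xs)" unfolding rank_def by (intro card_mono) auto
    moreover have "0 < rank x" unfolding rank_def using x by (auto simp: card_gt_0_iff)
    ultimately show "r \<in> {1..length xs}" using x card_length[of xs] by simp
  qed
  moreover have "card (rank ` set xs) = length xs"
    using card_image[OF inj] distinct_card[OF assms] by simp
  ultimately have "rank ` set xs = {1..length xs}" by (intro card_subset_eq) auto
  then have "is_perm (map rank xs)"
    using assms inj by (simp add: is_perm_iff distinct_map)
  moreover have "order_iso xs (map rank xs)" using iff by (simp add: order_iso_def)
  ultimately show thesis by (rule that)
qed

section \<open>From real grid lines to integer lines\<close>

definition pts :: "nat list \<Rightarrow> pt set" where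
  "pts \<pi> = (\<lambda>k. (int k + 1, int (\<pi> ! k))) ` {..<length \<pi>}"

fun cell_class :: "cell \<Rightarrow> nat list set" where
  "cell_class Inc = Av {[2, 1]}"
| "cell_class Dec = Av {[1, 2]}"
| "cell_class Void = empty_class"

lemma finite_pts: "finite (pts \<pi>)"
  by (simp add: pts_def)

lemma inj_on_pts:
  assumes "is_perm \<pi>"
  shows "inj_on fst (pts \<pi>)" "inj_on snd (pts \<pi>)"
  using assms by (auto simp: inj_on_def pts_def is_perm_iff nth_eq_iff_index_eq)

lemma Av_singleton: "Av {\<beta>} = {\<pi>. is_perm \<pi> \<and> \<not> \<beta> \<preceq> \<pi>}"
  by (simp add: Av_def)

lemma good_image_index:
  "good Inc ((\<lambda>k. (int k + 1, int (f k))) ` J) \<longleftrightarrow> (\<forall>k\<in>J. \<forall>l\<in>J. k < l \<longrightarrow> \<not> f l < f k)"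
  "good Dec ((\<lambda>k. (int k + 1, int (f k))) ` J) \<longleftrightarrow> (\<forall>k\<in>J. \<forall>l\<in>J. k < l \<longrightarrow> \<not> f k < f l)"
  by (auto simp: good_def)

text \<open>Membership depends only on the relative order of the entries, so the single
  standardization \<open>\<sigma>0\<close> decides it for the two monotone types. For
  \<open>Void\<close> the entries have to be absent.\<close>

lemma forms_member_iff:
  assumes "is_perm \<pi>"
  shows "forms_member \<pi> R (cell_class T) \<longleftrightarrow>
    good T {p\<in>pts \<pi>. (real_of_int (fst p), real_of_int (snd p)) \<in> R}"
proof -
  define e where "e = entries_in \<pi> R"
  have e: "e = map ((!) \<pi>) (filter (\<lambda>k. point \<pi> k \<in> R) [0..<length \<pi>])"
    unfolding e_def entries_in_def nths_eq_map_filter by simp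
  have dist: "distinct \<pi>" using assms by (simp add: is_perm_iff)
  then have "distinct e" unfolding e_def entries_in_def by (rule distinct_nthsI)
  then obtain \<sigma>0 where \<sigma>0: "is_perm \<sigma>0" "order_iso e \<sigma>0" by (rule standardization_exists)
  have S: "{p\<in>pts \<pi>. (real_of_int (fst p), real_of_int (snd p)) \<in> R} =
      (\<lambda>k. (int k + 1, int (\<pi> ! k))) ` {k. k < length \<pi> \<and> point \<pi> k \<in> R}" (is "?S = _")
    unfolding pts_def point_def by (auto simp: algebra_simps)
  show ?thesis
  proof (cases T)
    case Inc
    have "forms_member \<pi> R (cell_class T) \<longleftrightarrow> sorted_wrt (\<lambda>x y. \<not> y < x) e"
      unfolding forms_member_def Inc cell_class.simps e_def[symmetric] Av_singleton contained_21
      using order_iso_sorted_wrt(2)[of e] \<sigma>0 by blast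
    also have "\<dots> \<longleftrightarrow> good T ?S"
      unfolding e sorted_wrt_map sorted_wrt_filter_upt S Inc good_image_index
      by (auto intro: less_trans)
    finally show ?thesis .
  next
    case Dec
    have "forms_member \<pi> R (cell_class T) \<longleftrightarrow> sorted_wrt (\<lambda>x y. \<not> x < y) e"
      unfolding forms_member_def Dec cell_class.simps e_def[symmetric] Av_singleton contained_12
      using order_iso_sorted_wrt(1)[of e] \<sigma>0 by blast
    also have "\<dots> \<longleftrightarrow> good T ?S"
      unfolding e sorted_wrt_map sorted_wrt_filter_upt S Dec good_image_index
      by (auto intro: less_trans)
    finally show ?thesis .
  next
    case Void
    have "forms_member \<pi> R (cell_class T) \<longleftrightarrow> e = []"
      unfolding forms_member_def Void e_def[symmetric]
      by (auto simp: empty_class_def order_iso_def is_perm_iff)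
    also have "\<dots> \<longleftrightarrow> good T ?S"
      unfolding e S good_def Void by (auto simp: filter_empty_conv)
    finally show ?thesis .
  qed
qed

text \<open>As no point lies on a line, being left of the real \<open>v\<close> means being at most
  its floor. Row 0 of the matrix is the strip with index 1.\<close>

lemma is_gridding_iff:
  assumes M: "M \<in> carrier_mat 2 2"
    and cells: "M $$ (0, 0) = cell_class A" "M $$ (0, 1) = cell_class B"
      "M $$ (1, 0) = cell_class C" "M $$ (1, 1) = cell_class D"
    and \<pi>: "is_perm \<pi>"
    and off: "\<And>p. p \<in> pts \<pi> \<Longrightarrow> real_of_int (fst p) \<noteq> v \<and> real_of_int (snd p) \<noteq> h"
  shows "is_gridding M \<pi> [v] [h] \<longleftrightarrow> fits A B C D (pts \<pi>) \<lfloor>v\<rfloor> \<lfloor>h\<rfloor>"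
proof -
  have dim: "dim_row M = 2" "dim_col M = 2" using M by auto
  have two: "(\<forall>i<2. Q i) \<longleftrightarrow> Q 0 \<and> Q 1" for Q :: "nat \<Rightarrow> bool"
    by (auto simp: less_Suc_eq numeral_2_eq_2)
  have "\<forall>(x, y)\<in>plot \<pi>. x \<notin> set [v] \<and> y \<notin> set [h]"
  proof -
    have "real (k + 1) \<noteq> v \<and> real (\<pi> ! k) \<noteq> h" if "k < length \<pi>" for k
      using off[of "(int k + 1, int (\<pi> ! k))"] that by (auto simp: pts_def)
    then show ?thesis by (auto simp: plot_def point_def)
  qed
  then have "is_gridding M \<pi> [v] [h] \<longleftrightarrow>
      forms_member \<pi> (strip [v] 0 \<times> strip [h] 1) (cell_class A) \<and>
      forms_member \<pi> (strip [v] 1 \<times> strip [h] 1) (cell_class B) \<and>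
      forms_member \<pi> (strip [v] 0 \<times> strip [h] 0) (cell_class C) \<and>
      forms_member \<pi> (strip [v] 1 \<times> strip [h] 0) (cell_class D)"
    unfolding is_gridding_def dim two by (simp add: cells[simplified])
  moreover have fl: "real_of_int (fst p) < v \<longleftrightarrow> fst p \<le> \<lfloor>v\<rfloor>" "v < real_of_int (fst p) \<longleftrightarrow> \<lfloor>v\<rfloor> < fst p"
      "real_of_int (snd p) < h \<longleftrightarrow> snd p \<le> \<lfloor>h\<rfloor>" "h < real_of_int (snd p) \<longleftrightarrow> \<lfloor>h\<rfloor> < snd p"
    if "p \<in> pts \<pi>" for p
    using off[OF that] unfolding le_floor_iff floor_less_iff by auto
  have "{p\<in>pts \<pi>. (real_of_int (fst p), real_of_int (snd p)) \<in> strip [v] 0 \<times> strip [h] 1} =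
      {p\<in>pts_above (pts \<pi>) \<lfloor>h\<rfloor>. fst p \<le> \<lfloor>v\<rfloor>}"
    "{p\<in>pts \<pi>. (real_of_int (fst p), real_of_int (snd p)) \<in> strip [v] 1 \<times> strip [h] 1} =
      {p\<in>pts_above (pts \<pi>) \<lfloor>h\<rfloor>. \<lfloor>v\<rfloor> < fst p}"
    "{p\<in>pts \<pi>. (real_of_int (fst p), real_of_int (snd p)) \<in> strip [v] 0 \<times> strip [h] 0} =
      {p\<in>pts_below (pts \<pi>) \<lfloor>h\<rfloor>. fst p \<le> \<lfloor>v\<rfloor>}"
    "{p\<in>pts \<pi>. (real_of_int (fst p), real_of_int (snd p)) \<in> strip [v] 1 \<times> strip [h] 0} =
      {p\<in>pts_below (pts \<pi>) \<lfloor>h\<rfloor>. \<lfloor>v\<rfloor> < fst p}"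
    using fl unfolding pts_above_def pts_below_def strip_def by auto
  ultimately show ?thesis
    unfolding forms_member_iff[OF \<pi>] fits_def row_fits_def by simp
qed

lemma Grid_iff_fits:
  assumes M: "M \<in> carrier_mat 2 2"
    and cells: "M $$ (0, 0) = cell_class A" "M $$ (0, 1) = cell_class B"
      "M $$ (1, 0) = cell_class C" "M $$ (1, 1) = cell_class D"
    and \<pi>: "is_perm \<pi>"
  shows "\<pi> \<in> Grid M \<longleftrightarrow> (\<exists>v h. fits A B C D (pts \<pi>) v h)"
proof
  assume "\<pi> \<in> Grid M"
  then obtain vs hs where g: "is_gridding M \<pi> vs hs" unfolding Grid_def by blast
  then have "length vs = 1" "length hs = 1" using M unfolding is_gridding_def by auto
  then obtain v h where vh: "vs = [v]" "hs = [h]" by (auto simp: length_Suc_conv)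
  have "real_of_int (fst p) \<noteq> v \<and> real_of_int (snd p) \<noteq> h" if "p \<in> pts \<pi>" for p
    using g that unfolding vh is_gridding_def plot_def pts_def point_def by (auto simp: algebra_simps)
  then show "\<exists>v h. fits A B C D (pts \<pi>) v h"
    using g is_gridding_iff[OF M cells \<pi>] unfolding vh by blast
next
  assume "\<exists>v h. fits A B C D (pts \<pi>) v h"
  then obtain v h where f: "fits A B C D (pts \<pi>) v h" by blast
  \<comment> \<open>Half-integers meet no point and have the given integers as floors.\<close>
  have off: "real_of_int x \<noteq> real_of_int z + 1 / 2" for x z
  proof
    assume "real_of_int x = real_of_int z + 1 / 2"
    then have "real_of_int (2 * x) = real_of_int (2 * z + 1)" by simp
    then have "2 * x = 2 * z + 1" by (simp only: of_int_eq_iff)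
    then show False by presburger
  qed
  have "\<lfloor>real_of_int z + 1 / 2\<rfloor> = z" for z by linarith
  then have "is_gridding M \<pi> [real_of_int v + 1 / 2] [real_of_int h + 1 / 2]"
    using f off is_gridding_iff[OF M cells \<pi>, of "real_of_int v + 1 / 2" "real_of_int h + 1 / 2"]
    by metis
  then show "\<pi> \<in> Grid M" using \<pi> unfolding Grid_def by blast
qed

text \<open>The entries at the positions of \<open>S\<close> are standardized. Lines for the result
  give lines for \<open>S\<close>, so a set without lines yields a permutation without
  lines.\<close>

lemma contained_subset:
  assumes \<pi>: "is_perm \<pi>" and S: "S \<subseteq> pts \<pi>"
  obtains \<sigma> where "is_perm \<sigma>" "\<sigma> \<preceq> \<pi>" "length \<sigma> = card S"
    "\<And>A B C D v h. fits A B C D (pts \<sigma>) v h \<Longrightarrow> \<exists>v' h'. fits A B C D S v' h'"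
proof -
  define F where "F k = (int k + 1, int (\<pi> ! k))" for k
  have "inj F" by (auto simp: F_def inj_def)
  obtain K where K: "K \<subseteq> {..<length \<pi>}" "S = F ` K"
    using S unfolding pts_def F_def subset_image_iff by blast
  define ks where "ks = filter (\<lambda>k. k \<in> K) [0..<length \<pi>]"
  have ks: "set ks = K" "distinct ks" "sorted_wrt (<) ks"
    using K by (auto simp: ks_def sorted_wrt_filter_upt)
  have n: "nths \<pi> K = map ((!) \<pi>) ks" unfolding ks_def by (rule nths_eq_map_filter)
  have "distinct (nths \<pi> K)" using \<pi> by (simp add: is_perm_iff distinct_nthsI)
  then obtain \<sigma> where \<sigma>: "is_perm \<sigma>" "order_iso (nths \<pi> K) \<sigma>" by (rule standardization_exists)
  have len: "length \<sigma> = length ks" using \<sigma>(2) by (simp add: order_iso_def n)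
  show thesis
  proof (rule that)
    show "is_perm \<sigma>" by fact
    show "\<sigma> \<preceq> \<pi>" unfolding contained_def subseq_conv_nths using \<sigma>(2) by blast
    show "length \<sigma> = card S"
      using len ks distinct_card[of ks] card_image[OF inj_on_subset[OF \<open>inj F\<close>]] K(2) by simp
    fix A B C D v h assume f: "fits A B C D (pts \<sigma>) v h"
    \<comment> \<open>Index \<open>i\<close> of \<open>\<sigma>\<close> corresponds to position
      \<open>ks ! i\<close> of \<open>\<pi>\<close>, and both coordinates are ordered alike.\<close>
    have "\<exists>v' h'. fits A B C D ((\<lambda>i. F (ks ! i)) ` {..<length ks}) v' h'"
    proof (rule fits_transfer)
      show "fits A B C D ((\<lambda>i. (int i + 1, int (\<sigma> ! i))) ` {..<length ks}) v h"
        using f unfolding pts_def len .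
      fix i j assume ij: "i \<in> {..<length ks}" "j \<in> {..<length ks}"
      have "ks ! i < ks ! j \<longleftrightarrow> i < j"
        using ks(3) ij unfolding sorted_wrt_iff_nth_less
        by (metis lessThan_iff less_asym' linorder_neqE_nat)
      then show "fst (F (ks ! i)) < fst (F (ks ! j)) \<longleftrightarrow>
          fst (int i + 1, int (\<sigma> ! i)) < fst (int j + 1, int (\<sigma> ! j))"
        by (simp only: F_def fst_conv add_less_cancel_right of_nat_less_iff)
      show "snd (F (ks ! i)) < snd (F (ks ! j)) \<longleftrightarrow>
          snd (int i + 1, int (\<sigma> ! i)) < snd (int j + 1, int (\<sigma> ! j))"
        using \<sigma>(2) ij by (simp add: F_def order_iso_def n)
    qed simp
    moreover have "(\<lambda>i. F (ks ! i)) ` {..<length ks} = S"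
      unfolding K(2) ks(1)[symmetric] by (auto simp: set_conv_nth)
    ultimately show "\<exists>v' h'. fits A B C D S v' h'" by simp
  qed
qed

lemma finite_perms_length_le: "finite {\<pi>. is_perm \<pi> \<and> length \<pi> \<le> n}"
proof (rule finite_subset)
  show "{\<pi>. is_perm \<pi> \<and> length \<pi> \<le> n} \<subseteq> {xs. set xs \<subseteq> {1..n} \<and> length xs \<le> n}"
    by (auto simp: is_perm_iff)
qed (simp add: finite_lists_length_le)

theorem theorem1:
  fixes M :: "nat list set mat"
  assumes "M \<in> carrier_mat 2 2"
    and "monotone_matrix M"
  shows "finitely_based (Grid M)"
proof -
  have "\<exists>T. M $$ (i, j) = cell_class T" if "i < 2" "j < 2" for i j
  proof -
    have "M $$ (i, j) \<in> {Av {[1, 2]}, Av {[2, 1]}, empty_class}"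
      using assms that unfolding monotone_matrix_def by auto
    then show ?thesis by (metis cell_class.simps insertE singletonD)
  qed
  then obtain A B C D where cells: "M $$ (0, 0) = cell_class A" "M $$ (0, 1) = cell_class B"
      "M $$ (1, 0) = cell_class C" "M $$ (1, 1) = cell_class D"
    by (metis one_less_numeral_iff pos2 semiring_norm(76))
  note iff = Grid_iff_fits[OF assms(1) cells]
  \<comment> \<open>The witness inside a basis element standardizes to a contained permutation
    outside the class, which by minimality is the basis element itself.\<close>
  have "length \<beta> \<le> 16" if \<beta>: "\<beta> \<in> basis (Grid M)" for \<beta>
  proof -
    have perm: "is_perm \<beta>" and "\<beta> \<notin> Grid M"
      and minimal: "\<And>\<sigma>. is_perm \<sigma> \<Longrightarrow> \<sigma> \<notin> Grid M \<Longrightarrow> \<sigma> \<preceq> \<beta> \<Longrightarrow> \<sigma> = \<beta>"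
      using \<beta> unfolding basis_def by blast+
    then have "\<not> fits A B C D (pts \<beta>) v h" for v h using iff by blast
    then obtain S where S: "S \<subseteq> pts \<beta>" "card S \<le> 16" "\<And>v h. \<not> fits A B C D S v h"
      using fits_witness[OF finite_pts inj_on_pts[OF perm]] by metis
    obtain \<sigma> where \<sigma>: "is_perm \<sigma>" "\<sigma> \<preceq> \<beta>" "length \<sigma> = card S"
      "\<And>v h. fits A B C D (pts \<sigma>) v h \<Longrightarrow> \<exists>v' h'. fits A B C D S v' h'"
      using contained_subset[OF perm S(1)] by metis
    then have "\<sigma> \<notin> Grid M" using iff S(3) by blast
    then have "\<sigma> = \<beta>" using minimal \<sigma> by blast
    then show ?thesis using \<sigma>(3) S(2) by simp
  qed
  then have "basis (Grid M) \<subseteq> {\<pi>. is_perm \<pi> \<and> length \<pi> \<le> 16}" unfolding basis_def by blast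
  then show ?thesis unfolding finitely_based_def using finite_perms_length_le finite_subset by blast
qed

end
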